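(* Let $f:(a,b)\to\mathbb{R}$ be a $\Phi$-convex function with $\Phi:[0,b-a]\to[0,\infty)$, and let $\varphi:(a,b)\to\mathbb{R}$ be a function such that $f(u)+(x-u)\varphi(u)\le f(x)+\Phi(|u-x|)$ for all $x,u\in(a,b)$. Let $x_1,\dots,x_n\in(a,b)$, let $(a_1,\dots,a_n)$ be a nonnegative $n$-tuple with $A_n=\sum_{i=1}^n a_i>0$, and let $\overline{x}=\frac{1}{A_n}\sum_{i=1}^n a_ix_i$. Then $$\frac{1}{A_n}\sum_{i=1}^n a_if(x_i)-f(\overline{x})\le\frac{1}{A_n}\sum_{i=1}^n a_i\varphi(x_i)(x_i-\overline{x})+\frac{1}{A_n}\sum_{i=1}^n a_i\Phi(|\overline{x}-x_i|).$$
   Context: A real function $f$ on an interval with endpoints $a<b$ is $\Phi$-convex, with error function $\Phi:[0,b-a]\to[0,\infty)$, if $tf(x)+(1-t)f(y)+t\Phi((1-t)|x-y|)+(1-t)\Phi(t|x-y|)\ge f(tx+(1-t)y)$ for all $x,y$ in the interval and all $t\in[0,1]$. It is known that for such $f$ a function $\varphi$ with $f(u)+(x-u)\varphi(u)\le f(x)+\Phi(|u-x|)$ for all $x,u$ exists. *)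

theory Defs
  imports "HOL-Analysis.Analysis"
begin

(* For an interval I with endpoints a < b, the error function is meant to map
   [0, b - a] into [0, \<infinity>); this is the predicate error_function below and is not
   repeated in phi_convex_on. Every argument at which phi_convex_on evaluates \<Phi> lies in
   [0, b - a], so the values of the total function \<Phi> elsewhere are irrelevant, as are
   those of f outside I. *)

definition error_function :: "real \<Rightarrow> real \<Rightarrow> (real \<Rightarrow> real) \<Rightarrow> bool" where
  "error_function a b \<Phi> \<longleftrightarrow> \<Phi> \<in> {0..b - a} \<rightarrow> {0..}"

definition phi_convex_on :: "real set \<Rightarrow> (real \<Rightarrow> real) \<Rightarrow> (real \<Rightarrow> real) \<Rightarrow> bool" where
  "phi_convex_on I \<Phi> f \<longleftrightarrow>
     (\<forall>x\<in>I. \<forall>y\<in>I. \<forall>t\<in>{0..1}.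
        t * f x + (1 - t) * f y
          + t * \<Phi> ((1 - t) * \<bar>x - y\<bar>) + (1 - t) * \<Phi> (t * \<bar>x - y\<bar>)
        \<ge> f (t * x + (1 - t) * y))"

end

theory Submission
  imports Defs
begin

text \<open>The line through \<open>(x i, f (x i))\<close> with slope \<open>\<phi> (x i)\<close>
  supports \<open>f\<close> up to the error \<open>\<Phi>\<close>. Evaluating each of these lines at
  the common point \<open>xbar\<close> bounds \<open>f (x i)\<close> from above by
  \<open>f xbar\<close> plus a slope term and an error term; the weighted mean of these bounds is
  the claim.\<close>

theorem theorem13:
  fixes a b :: real
    and f \<Phi> \<phi> :: "real \<Rightarrow> real"
    and n :: nat
    and x w :: "nat \<Rightarrow> real"
    and A xbar :: real
  assumes "a < b"
    and "error_function a b \<Phi>"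
    and "phi_convex_on {a<..<b} \<Phi> f"
    and "\<And>y u. y \<in> {a<..<b} \<Longrightarrow> u \<in> {a<..<b} \<Longrightarrow>
           f u + (y - u) * \<phi> u \<le> f y + \<Phi> \<bar>u - y\<bar>"
    and "\<And>i. i \<in> {1..n} \<Longrightarrow> x i \<in> {a<..<b}"
    and "\<And>i. i \<in> {1..n} \<Longrightarrow> w i \<ge> 0"
    and "A = (\<Sum>i=1..n. w i)"
    and "A > 0"
    and "xbar = 1 / A * (\<Sum>i=1..n. w i * x i)"
  shows "1 / A * (\<Sum>i=1..n. w i * f (x i)) - f xbar
         \<le> 1 / A * (\<Sum>i=1..n. w i * \<phi> (x i) * (x i - xbar))
           + 1 / A * (\<Sum>i=1..n. w i * \<Phi> \<bar>xbar - x i\<bar>)"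
proof -
  \<comment> \<open>The support inequality may be used at \<open>xbar\<close> only inside the
    interval. The weights \<open>w i / A\<close> are nonnegative with sum 1, so \<open>xbar\<close>
    is a convex combination of points of a convex set.\<close>
  have "(\<Sum>i=1..n. (w i / A) *\<^sub>R x i) \<in> {a<..<b}"
    using assms by (intro convex_sum) (auto simp: sum_divide_distrib[symmetric])
  also have "(\<Sum>i=1..n. (w i / A) *\<^sub>R x i) = xbar"
    using assms by (simp add: sum_divide_distrib)
  finally have xbar: "xbar \<in> {a<..<b}" .
  have "w i * f (x i) \<le> w i * f xbar + w i * \<phi> (x i) * (x i - xbar) + w i * \<Phi> \<bar>xbar - x i\<bar>"
    if "i \<in> {1..n}" for i
  proof -
    \<comment> \<open>The base point is \<open>u = x i\<close> and the evaluation point is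
      \<open>y = xbar\<close>; the opposite choice would give slopes at \<open>xbar\<close> and a
      lower bound for \<open>f (x i)\<close>.\<close>
    have "f (x i) \<le> f xbar + \<phi> (x i) * (x i - xbar) + \<Phi> \<bar>xbar - x i\<bar>"
      using assms(4)[OF xbar assms(5)[OF that]] by (simp add: algebra_simps abs_minus_commute)
    from mult_left_mono[OF this assms(6)[OF that]] show ?thesis
      by (simp add: algebra_simps)
  qed
  then have "(\<Sum>i=1..n. w i * f (x i))
      \<le> (\<Sum>i=1..n. w i * f xbar + w i * \<phi> (x i) * (x i - xbar) + w i * \<Phi> \<bar>xbar - x i\<bar>)"
    by (rule sum_mono)
  \<comment> \<open>The constant \<open>f xbar\<close> collects the total weight \<open>A\<close>,
    which the final division by \<open>A > 0\<close> cancels.\<close>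
  also have "\<dots> = A * f xbar + (\<Sum>i=1..n. w i * \<phi> (x i) * (x i - xbar))
      + (\<Sum>i=1..n. w i * \<Phi> \<bar>xbar - x i\<bar>)"
    by (simp add: sum.distrib sum_distrib_right assms(7))
  finally show ?thesis
    using \<open>A > 0\<close> by (simp add: divide_simps) (simp add: algebra_simps)
qed

end
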